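(* Let $k\geq 2$ be an integer and let $p_1,\dots,p_m$ be its distinct prime factors. Then for every positive integer $n$, $$\mathfrak{s}((\mathbb{Z}/k\mathbb{Z})^n)< 3k\left(r(\mathbb{F}_{p_1}^{n})+\dots+r(\mathbb{F}_{p_m}^{n})\right).$$
   Context: For a finite abelian group $G$ (written additively), $\exp(G)$ denotes its exponent, i.e. the least common multiple of the orders of all elements of $G$. For a non-trivial finite abelian group $G$, the Erdős–Ginzburg–Ziv constant $\mathfrak{s}(G)$ is the smallest integer $s$ such that every sequence of $s$ (not necessarily distinct) elements of $G$ has a subsequence of length $\exp(G)$ whose elements sum to zero in $G$. A three-term arithmetic progression in $G$ is a set $\{x,y,z\}\subseteq G$ with $x,y,z$ distinct and $x+z=2y$. For a finite abelian group $G$, $r(G)$ denotes the largest size of a subset of $G$ that does not contain a three-term arithmetic progression. $\mathbb{F}_p^n$ is regarded as an additive group. *)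

theory Defs
  imports "HOL-Algebra.Algebra" "HOL-Library.Sublist"
    "HOL-Computational_Algebra.Primes"
begin

text \<open>Abelian groups are HOL-Algebra groups and hence written multiplicatively: products stand for
  sums and \<open>\<one>\<close> for zero. The definitions below are meant for finite commutative groups.\<close>

definition group_exponent :: "('a, 'b) monoid_scheme \<Rightarrow> nat" where
  "group_exponent G = Lcm (group.ord G ` carrier G)"

definition seq_sum :: "('a, 'b) monoid_scheme \<Rightarrow> 'a list \<Rightarrow> 'a" where
  "seq_sum G xs = foldr (\<lambda>x y. x \<otimes>\<^bsub>G\<^esub> y) xs \<one>\<^bsub>G\<^esub>"

text \<open>The least element exists for finite commutative \<open>G\<close>: by the pigeonhole principle, a sequence of
  length \<open>(group_exponent G - 1) * order G + 1\<close> has \<open>group_exponent G\<close> equal terms, and these sum to zero.\<close>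

definition egz_constant :: "('a, 'b) monoid_scheme \<Rightarrow> nat" where
  "egz_constant G =
     (LEAST s. \<forall>xs. set xs \<subseteq> carrier G \<and> length xs = s \<longrightarrow>
        (\<exists>ys. subseq ys xs \<and> length ys = group_exponent G \<and> seq_sum G ys = \<one>\<^bsub>G\<^esub>))"

definition three_term_AP :: "('a, 'b) monoid_scheme \<Rightarrow> 'a set \<Rightarrow> bool" where
  "three_term_AP G P \<longleftrightarrow>
     (\<exists>x\<in>carrier G. \<exists>y\<in>carrier G. \<exists>z\<in>carrier G.
        P = {x, y, z} \<and> x \<noteq> y \<and> y \<noteq> z \<and> x \<noteq> z \<and> x \<otimes>\<^bsub>G\<^esub> z = y [^]\<^bsub>G\<^esub> (2::nat))"

definition max_AP_free :: "('a, 'b) monoid_scheme \<Rightarrow> nat" where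
  "max_AP_free G = Max {card A | A. A \<subseteq> carrier G \<and> \<not> (\<exists>P\<subseteq>A. three_term_AP G P)}"

text \<open>The group \<open>(\<int>/k\<int>)\<^sup>n\<close>; for prime \<open>k\<close> this is the additive group of \<open>F\<^sub>k\<^sup>n\<close>.\<close>

definition ZMod_power :: "nat \<Rightarrow> nat \<Rightarrow> (nat \<Rightarrow> int) monoid" where
  "ZMod_power k n = product_group {..<n} (\<lambda>_. integer_mod_group k)"

end

theory Submission
  imports Defs "HOL-Number_Theory.Cong"
begin

text \<open>Let \<open>p\<close> be prime and suppose that a sequence in \<open>F\<^sub>p\<^sup>n\<close> has no zero-sum subsequence of length \<open>p\<close>.
  For every term \<open>y\<close>, at most \<open>p - 2\<close> further terms suffice to meet all copies of \<open>y\<close> and all pairs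
  with midpoint \<open>y\<close>. Joining \<open>y\<close> to these terms gives a digraph of outdegree at most \<open>p - 2\<close>, which has an
  independent set containing a proportion \<open>1 / (2 p - 3)\<close> of the terms; it consists of distinct elements
  and is free of three-term progressions. Hence \<open>(2 p - 3) r(F\<^sub>p\<^sup>n) + 1\<close> terms force a zero sum.
  For composite moduli, \<open>s((Z/bp)\<^sup>n) - 1 \<le> b (s((Z/p)\<^sup>n) - 1) + (s((Z/b)\<^sup>n) - 1)\<close> yields
  \<open>s((Z/k)\<^sup>n) \<le> 2 k S + 1\<close> by induction, where \<open>S\<close> is the sum of the \<open>r(F\<^sub>p\<^sup>n)\<close> over the primes
  \<open>p\<close> dividing \<open>k\<close>.\<close>

section \<open>Independent sets in digraphs of bounded outdegree\<close>

text \<open>Counting edges by head and by tail, some vertex has indegree at most \<open>d\<close>.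
  Together with its in- and out-neighbours it accounts for at most \<open>2 * d + 1\<close>
  vertices; keep it, delete these and recurse.\<close>

lemma independent_set_bounded_outdegree:
  fixes M :: "'a \<Rightarrow> 'a set"
  assumes "finite V" and "\<And>v. v \<in> V \<Longrightarrow> finite (M v)" and "\<And>v. v \<in> V \<Longrightarrow> card (M v) \<le> d"
  shows "\<exists>I\<subseteq>V. card V \<le> (2 * d + 1) * card I \<and> (\<forall>x\<in>I. \<forall>y\<in>I. x \<noteq> y \<longrightarrow> y \<notin> M x)"
  using assms
proof (induction "card V" arbitrary: V rule: less_induct)
  case less
  show ?case
  proof (cases "V = {}")
    case True
    then show ?thesis by auto
  next
    case False
    have "\<exists>v\<in>V. card {u\<in>V. v \<in> M u} \<le> d"
    proof (rule ccontr)
      assume "\<not> ?thesis"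
      then have "(\<Sum>v\<in>V. d + 1) \<le> (\<Sum>v\<in>V. card {u\<in>V. v \<in> M u})"
        by (intro sum_mono) force
      also have "\<dots> = (\<Sum>u\<in>V. card {v\<in>V. v \<in> M u})"
        by (rule sum_multicount_gen) (use less.prems in auto)
      also have "\<dots> \<le> (\<Sum>u\<in>V. d)"
      proof (rule sum_mono)
        fix u assume u: "u \<in> V"
        have "card {v\<in>V. v \<in> M u} \<le> card (M u)"
          by (rule card_mono) (use less.prems(2) u in auto)
        then show "card {v\<in>V. v \<in> M u} \<le> d"
          using less.prems(3) u by force
      qed
      finally show False
        using False less.prems(1) by (simp add: card_gt_0_iff)
    qed
    then obtain v where v: "v \<in> V" "card {u\<in>V. v \<in> M u} \<le> d" by blast
    \<comment> \<open>Outside \<open>R\<close> there is no edge to or from \<open>v\<close>, so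
      \<open>v\<close> can join any independent set found there.\<close>
    define R where "R = insert v ({u\<in>V. v \<in> M u} \<union> M v)"
    have finR: "finite R"
      unfolding R_def using less.prems(1,2) v by auto
    have "card R \<le> Suc (card ({u\<in>V. v \<in> M u} \<union> M v))"
      unfolding R_def by (rule card_insert_le_m1) auto
    also have "card ({u\<in>V. v \<in> M u} \<union> M v) \<le> card {u\<in>V. v \<in> M u} + card (M v)"
      by (rule card_Un_le)
    finally have cardR: "card R \<le> 2 * d + 1"
      using v less.prems(3)[OF v(1)] by simp
    have "card (V - R) < card V"
      by (rule psubset_card_mono) (use less.prems(1) v R_def in auto)
    then have "\<exists>I\<subseteq>V - R. card (V - R) \<le> (2 * d + 1) * card I \<and>
        (\<forall>x\<in>I. \<forall>y\<in>I. x \<noteq> y \<longrightarrow> y \<notin> M x)"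
      by (rule less.hyps) (use less.prems in auto)
    then obtain I where I: "I \<subseteq> V - R" "card (V - R) \<le> (2 * d + 1) * card I"
        "\<forall>x\<in>I. \<forall>y\<in>I. x \<noteq> y \<longrightarrow> y \<notin> M x"
      by blast
    have finI: "finite I"
      using I(1) less.prems(1) finite_subset by blast
    have "v \<notin> I"
      using I(1) R_def by auto
    have "card V - card R \<le> card (V - R)"
      by (rule diff_card_le_card_Diff[OF finR])
    then have "card V \<le> (2 * d + 1) * card (insert v I)"
      using I(2) cardR \<open>v \<notin> I\<close> finI by simp
    moreover have "\<forall>x\<in>insert v I. \<forall>y\<in>insert v I. x \<noteq> y \<longrightarrow> y \<notin> M x"
      using I R_def by blast
    ultimately show ?thesis
      using I(1) v(1) by (intro exI[of _ "insert v I"]) auto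
  qed
qed

section \<open>Coordinates and exponent of \<open>ZMod_power k n\<close>\<close>

lemma carrier_ZMod_power:
  "k > 0 \<Longrightarrow> carrier (ZMod_power k n) = (\<Pi>\<^sub>E i\<in>{..<n}. {0..<int k})"
  by (simp add: ZMod_power_def carrier_integer_mod_group)

lemma mult_ZMod_power:
  "x \<otimes>\<^bsub>ZMod_power k n\<^esub> y = (\<lambda>i\<in>{..<n}. (x i + y i) mod int k)"
  by (simp add: ZMod_power_def)

lemma one_ZMod_power: "\<one>\<^bsub>ZMod_power k n\<^esub> = (\<lambda>i\<in>{..<n}. 0)"
  by (simp add: ZMod_power_def)

lemma group_ZMod_power: "group (ZMod_power k n)"
  by (simp add: ZMod_power_def)

lemma pow_ZMod_power:
  "x [^]\<^bsub>ZMod_power k n\<^esub> (m::nat) = (\<lambda>i\<in>{..<n}. (int m * x i) mod int k)"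
proof (induction m)
  case (Suc m)
  then show ?case
    by (auto simp: mult_ZMod_power fun_eq_iff restrict_def mod_simps algebra_simps)
qed (simp add: one_ZMod_power)

lemma finite_carrier_ZMod_power: "k > 0 \<Longrightarrow> finite (carrier (ZMod_power k n))"
  by (simp add: carrier_ZMod_power finite_PiE)

lemma group_exponent_ZMod_power:
  assumes "k \<ge> 2" and "n \<ge> 1"
  shows "group_exponent (ZMod_power k n) = k"
proof -
  interpret group "ZMod_power k n" by (rule group_ZMod_power)
  have "ord x dvd k" if "x \<in> carrier (ZMod_power k n)" for x
    using pow_eq_id[OF that, of k] by (simp add: pow_ZMod_power one_ZMod_power)
  moreover
  \<comment> \<open>The all-ones vector has order divisible by \<open>k\<close>; coordinate 0,
    available as \<open>n \<ge> 1\<close>, shows this.\<close>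
  define u :: "nat \<Rightarrow> int" where "u = (\<lambda>i\<in>{..<n}. 1)"
  have u: "u \<in> carrier (ZMod_power k n)"
    using assms by (auto simp: u_def carrier_ZMod_power)
  have "k dvd ord u"
  proof -
    have "u [^]\<^bsub>ZMod_power k n\<^esub> ord u = \<one>\<^bsub>ZMod_power k n\<^esub>"
      using u by simp
    then have "(u [^]\<^bsub>ZMod_power k n\<^esub> ord u) 0 = \<one>\<^bsub>ZMod_power k n\<^esub> 0"
      by simp
    then have "int (ord u) mod int k = 0"
      using assms by (simp add: pow_ZMod_power one_ZMod_power u_def)
    then show ?thesis
      by (auto dest: mod_0_imp_dvd)
  qed
  ultimately show ?thesis
    unfolding group_exponent_def using u
    by (intro dvd_antisym Lcm_least) (auto intro: dvd_trans[OF _ dvd_Lcm])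
qed

lemma seq_sum_ZMod_power:
  "seq_sum (ZMod_power k n) xs = (\<lambda>i\<in>{..<n}. (\<Sum>x\<leftarrow>xs. x i) mod int k)"
  by (induction xs)
    (auto simp: seq_sum_def one_ZMod_power mult_ZMod_power fun_eq_iff restrict_def mod_simps)

section \<open>Sizes of progression-free sets\<close>

lemma card_le_max_AP_free:
  assumes "finite (carrier G)" and "A \<subseteq> carrier G" and "\<not> (\<exists>P\<subseteq>A. three_term_AP G P)"
  shows "card A \<le> max_AP_free G"
proof -
  have "{card A | A. A \<subseteq> carrier G \<and> \<not> (\<exists>P\<subseteq>A. three_term_AP G P)} \<subseteq> card ` Pow (carrier G)"
    by auto
  then show ?thesis
    unfolding max_AP_free_def using assms by (intro Max_ge) (auto intro: finite_subset)
qed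

lemma max_AP_free_pos:
  assumes "finite (carrier G)" and "x \<in> carrier G"
  shows "max_AP_free G > 0"
proof -
  have "\<not> (\<exists>P\<subseteq>{x}. three_term_AP G P)"
    by (auto simp: three_term_AP_def)
  then show ?thesis
    using card_le_max_AP_free[of G "{x}"] assms by simp
qed

section \<open>Zero-sum index sets and multiplicativity in the modulus\<close>

text \<open>Index sets keep equal terms apart and make disjoint blocks easy to express. Terms are
  integers rather than residues so that block sums can be divided by the modulus.\<close>

definition zero_sum_bound :: "nat \<Rightarrow> nat \<Rightarrow> nat \<Rightarrow> bool" where
  "zero_sum_bound k n N \<longleftrightarrow> (\<forall>(I::nat set) (a::nat \<Rightarrow> nat \<Rightarrow> int). finite I \<and> N \<le> card I \<longrightarrow>
     (\<exists>J\<subseteq>I. card J = k \<and> (\<forall>i<n. int k dvd (\<Sum>j\<in>J. a j i))))"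

lemma zero_sum_boundD:
  fixes I :: "nat set" and a :: "nat \<Rightarrow> nat \<Rightarrow> int"
  assumes "zero_sum_bound k n N" "finite I" "N \<le> card I"
  obtains J where "J \<subseteq> I" "card J = k" "\<And>i. i < n \<Longrightarrow> int k dvd (\<Sum>j\<in>J. a j i)"
  using assms unfolding zero_sum_bound_def by blast

lemma zero_sum_bound_mono: "zero_sum_bound k n N \<Longrightarrow> N \<le> N' \<Longrightarrow> zero_sum_bound k n N'"
  unfolding zero_sum_bound_def using le_trans by blast

text \<open>Greedy choice: once \<open>t\<close> blocks are removed, at least \<open>A + 1\<close>
  indices remain for the next one. Adding \<open>k\<close> on the right avoids a truncated
  \<open>t - 1\<close>.\<close>

lemma disjoint_zero_sum_blocks:
  fixes I :: "nat set" and a :: "nat \<Rightarrow> nat \<Rightarrow> int"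
  assumes k: "zero_sum_bound k n (A + 1)" and "finite I" and "k * t + A + 1 \<le> card I + k"
  shows "\<exists>B. (\<forall>s<t. B s \<subseteq> I \<and> card (B s) = k \<and> (\<forall>i<n. int k dvd (\<Sum>j\<in>B s. a j i))) \<and>
    disjoint_family_on B {..<t}"
  using assms(3)
proof (induction t)
  case 0
  show ?case by (simp add: disjoint_family_on_def)
next
  case (Suc t)
  then obtain B where B: "\<forall>s<t. B s \<subseteq> I \<and> card (B s) = k \<and> (\<forall>i<n. int k dvd (\<Sum>j\<in>B s. a j i))"
    "disjoint_family_on B {..<t}" by auto
  define U where "U = (\<Union>s<t. B s)"
  have U: "U \<subseteq> I"
    using B(1) by (auto simp: U_def)
  then have finU: "finite U"
    using \<open>finite I\<close> by (rule finite_subset)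
  have "card U \<le> (\<Sum>s<t. card (B s))"
    unfolding U_def by (rule card_UN_le) simp
  also have "\<dots> = k * t"
    using B(1) by simp
  finally have "A + 1 \<le> card (I - U)"
    using Suc.prems U finU by (simp add: card_Diff_subset)
  then obtain C where C: "C \<subseteq> I - U" "card C = k" "\<And>i. i < n \<Longrightarrow> int k dvd (\<Sum>j\<in>C. a j i)"
    using zero_sum_boundD[OF k, of "I - U" a] \<open>finite I\<close> by auto
  have "disjoint_family_on (B(t := C)) {..<Suc t}"
    using B(2) C(1) unfolding lessThan_Suc
    by (subst disjoint_family_on_insert) (auto simp: U_def disjoint_family_on_def)
  moreover have "\<forall>s<Suc t. (B(t := C)) s \<subseteq> I \<and> card ((B(t := C)) s) = k \<and>
      (\<forall>i<n. int k dvd (\<Sum>j\<in>(B(t := C)) s. a j i))"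
    using B(1) C by (auto simp: less_Suc_eq)
  ultimately show ?case
    by blast
qed

text \<open>Extract \<open>B + 1\<close> disjoint blocks with sums divisible by \<open>k\<close>,
  divide these sums by \<open>k\<close>, and apply the bound for \<open>l\<close> to the quotients.
  The union of the \<open>l\<close> selected blocks is the required set.\<close>

lemma zero_sum_bound_mult:
  assumes k: "zero_sum_bound k n (A + 1)" and l: "zero_sum_bound l n (B + 1)"
  shows "zero_sum_bound (k * l) n (k * B + A + 1)"
  unfolding zero_sum_bound_def
proof (intro allI impI, elim conjE)
  fix I :: "nat set" and a :: "nat \<Rightarrow> nat \<Rightarrow> int"
  assume I: "finite I" "k * B + A + 1 \<le> card I"
  then have "k * (B + 1) + A + 1 \<le> card I + k"
    by simp
  then obtain D where D: "\<And>s. s < B + 1 \<Longrightarrow> D s \<subseteq> I" "\<And>s. s < B + 1 \<Longrightarrow> card (D s) = k"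
    "\<And>s i. s < B + 1 \<Longrightarrow> i < n \<Longrightarrow> int k dvd (\<Sum>j\<in>D s. a j i)" "disjoint_family_on D {..<B + 1}"
    using disjoint_zero_sum_blocks[OF k I(1), of "B + 1" a] by blast
  define c where "c s i = (\<Sum>j\<in>D s. a j i) div int k" for s i
  obtain J where J: "J \<subseteq> {..<B + 1}" "card J = l" "\<And>i. i < n \<Longrightarrow> int l dvd (\<Sum>s\<in>J. c s i)"
    using zero_sum_boundD[OF l, of "{..<B + 1}" c] by auto
  have J': "finite J" "\<And>s. s \<in> J \<Longrightarrow> s < B + 1"
    using J(1) finite_subset by auto
  have fin: "finite (D s)" if "s \<in> J" for s
    using D(1) I(1) J'(2) that finite_subset by metis
  have dj: "\<forall>s\<in>J. \<forall>s'\<in>J. s \<noteq> s' \<longrightarrow> D s \<inter> D s' = {}"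
    using D(4) J'(2) unfolding disjoint_family_on_def by auto
  have "card (\<Union>s\<in>J. D s) = k * l"
    using card_UN_disjoint[of J D] J' fin dj D(2) J(2) by simp
  moreover have "int (k * l) dvd (\<Sum>j\<in>(\<Union>s\<in>J. D s). a j i)" if i: "i < n" for i
  proof -
    have "(\<Sum>j\<in>(\<Union>s\<in>J. D s). a j i) = (\<Sum>s\<in>J. \<Sum>j\<in>D s. a j i)"
      using sum.UNION_disjoint[of J D "\<lambda>j. a j i"] J' fin dj by auto
    also have "\<dots> = int k * (\<Sum>s\<in>J. c s i)"
      using D(3)[OF J'(2) i] by (simp add: c_def sum_distrib_left)
    finally show ?thesis
      using J(3)[OF i] by (simp add: mult_dvd_mono)
  qed
  moreover have "(\<Union>s\<in>J. D s) \<subseteq> I"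
    using D(1) J'(2) by blast
  ultimately show "\<exists>J\<subseteq>I. card J = k * l \<and> (\<forall>i<n. int (k * l) dvd (\<Sum>j\<in>J. a j i))"
    by blast
qed

section \<open>Prime moduli: from zero-sum-free families to progression-free sets\<close>

text \<open>If the sum of \<open>T\<close> is congruent to \<open>card T\<close> times the element \<open>a y\<close>, then topping \<open>T\<close> up with copies
  of \<open>a y\<close> to exactly \<open>p\<close> terms gives sum \<open>p\<close> times \<open>a y\<close>, i.e. zero. Taking \<open>T\<close> maximal, every pair with
  midpoint \<open>a y\<close> meets \<open>T\<close> or the copies of \<open>a y\<close>.\<close>

lemma midpoint_hitting_set:
  fixes I :: "nat set" and a :: "nat \<Rightarrow> nat \<Rightarrow> int"
  assumes I: "finite I" and p: "p > 0" and y: "y \<in> I"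
    and no: "\<not> (\<exists>J\<subseteq>I. card J = p \<and> (\<forall>i<n. int p dvd (\<Sum>j\<in>J. a j i)))"
  shows "\<exists>M\<subseteq>I - {y}. card M \<le> p - 2 \<and>
    (\<forall>x\<in>I - {y}. (\<forall>i<n. [a x i = a y i] (mod int p)) \<longrightarrow> x \<in> M) \<and>
    (\<forall>x\<in>I - {y}. \<forall>z\<in>I - {y}. x \<noteq> z \<longrightarrow> (\<forall>i<n. [a x i + a z i = 2 * a y i] (mod int p)) \<longrightarrow>
       x \<in> M \<or> z \<in> M)"
proof -
  \<comment> \<open>\<open>E\<close> indexes all copies of \<open>a y\<close>, including
    \<open>y\<close> itself; \<open>F\<close> collects the candidates for \<open>T\<close>, taken
    outside \<open>E\<close>.\<close>
  define E where "E = {x\<in>I. \<forall>i<n. [a x i = a y i] (mod int p)}"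
  define F where "F = {T. T \<subseteq> I - E \<and> card T \<le> p \<and>
    (\<forall>i<n. [(\<Sum>j\<in>T. a j i) = int (card T) * a y i] (mod int p))}"
  have E: "E \<subseteq> I" "finite E" "y \<in> E"
    using I y by (auto simp: E_def)
  have "finite F"
    by (rule finite_subset[of _ "Pow I"]) (use I in \<open>auto simp: F_def\<close>)
  moreover have "{} \<in> F"
    by (simp add: F_def)
  ultimately obtain T where T: "T \<in> F" and max: "\<And>S. S \<in> F \<Longrightarrow> T \<subseteq> S \<Longrightarrow> T = S"
    using finite_has_maximal[of F] by blast
  have TI: "T \<subseteq> I - E" and Tp: "card T \<le> p"
    and Ts: "\<And>i. i < n \<Longrightarrow> [(\<Sum>j\<in>T. a j i) = int (card T) * a y i] (mod int p)"
    using T by (auto simp: F_def)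
  have finT: "finite T" and TE: "T \<inter> E = {}"
    using TI I finite_subset by auto
  have small: "card T + card E < p"
  proof (rule ccontr)
    assume "\<not> ?thesis"
    then have "p - card T \<le> card E" by simp
    then obtain C where C: "C \<subseteq> E" "card C = p - card T"
      using obtain_subset_with_card_n by metis
    have finC: "finite C" and TC: "T \<inter> C = {}"
      using C(1) E TE finite_subset by auto
    have "card (T \<union> C) = p"
      using finT finC TC C(2) Tp by (simp add: card_Un_disjoint)
    moreover have "int p dvd (\<Sum>j\<in>T \<union> C. a j i)" if i: "i < n" for i
    proof -
      have "[(\<Sum>j\<in>C. a j i) = (\<Sum>j\<in>C. a y i)] (mod int p)"
        by (rule cong_sum) (use C(1) i in \<open>auto simp: E_def\<close>)
      then have "[(\<Sum>j\<in>T. a j i) + (\<Sum>j\<in>C. a j i) = int (card T) * a y i + (\<Sum>j\<in>C. a y i)] (mod int p)"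
        by (intro cong_add Ts i)
      also have "int (card T) * a y i + (\<Sum>j\<in>C. a y i) = int p * a y i"
        using C(2) Tp by (simp add: of_nat_diff algebra_simps)
      finally have "[(\<Sum>j\<in>T \<union> C. a j i) = int p * a y i] (mod int p)"
        using finT finC TC by (simp add: sum.union_disjoint)
      then show ?thesis
        using cong_dvd_iff by fastforce
    qed
    moreover have "T \<union> C \<subseteq> I"
      using TI C(1) E by auto
    ultimately show False
      using no by blast
  qed
  have hit: "x \<in> T \<union> E \<or> z \<in> T \<union> E"
    if "x \<in> I" "z \<in> I" "x \<noteq> z" and mid: "\<And>i. i < n \<Longrightarrow> [a x i + a z i = 2 * a y i] (mod int p)" for x z
  proof (rule ccontr)
    assume out: "\<not> ?thesis"
    \<comment> \<open>As \<open>y\<close> lies in \<open>E\<close>, \<open>small\<close> leaves room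
      for two more indices. A pair that is not hit could thus be added to \<open>T\<close>, against
      maximality.\<close>
    have "card E > 0"
      using E card_gt_0_iff by blast
    then have cd: "card (insert x (insert z T)) = card T + 2" "card T + 2 \<le> p"
      using finT out that(3) small by auto
    have "[(\<Sum>j\<in>insert x (insert z T). a j i) = int (card T + 2) * a y i] (mod int p)" if i: "i < n" for i
    proof -
      have "[(a x i + a z i) + (\<Sum>j\<in>T. a j i) = 2 * a y i + int (card T) * a y i] (mod int p)"
        by (intro cong_add mid Ts i)
      then show ?thesis
        using finT out \<open>x \<noteq> z\<close> by (simp add: algebra_simps)
    qed
    then have "insert x (insert z T) \<in> F"
      unfolding F_def using cd TI out that(1,2) by auto
    then show False
      using max[of "insert x (insert z T)"] out by blast
  qed
  \<comment> \<open>Dropping \<open>y\<close> from \<open>E\<close> improves the bound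
    \<open>p - 1\<close> given by \<open>small\<close> to \<open>p - 2\<close>.\<close>
  define M where "M = T \<union> (E - {y})"
  have "card M \<le> card T + (card E - 1)"
    unfolding M_def using card_Un_le[of T "E - {y}"] E by simp
  moreover have "card E > 0"
    using E card_gt_0_iff by blast
  ultimately have "card M \<le> p - 2"
    using small by linarith
  moreover have "M \<subseteq> I - {y}"
    using TI E by (auto simp: M_def)
  ultimately show ?thesis
    using hit by (intro exI[of _ M]) (auto simp: M_def E_def)
qed

text \<open>In the digraph joining \<open>y\<close> to \<open>M y\<close>, two indices with equal
  residues are adjacent, and the midpoint of a progression is joined to one of its ends. Hence
  reduction mod \<open>p\<close> is injective on an independent set, with progression-free
  image.\<close>

lemma zero_sum_bound_AP_free:
  assumes p: "p \<ge> 2"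
  shows "zero_sum_bound p n ((2 * p - 3) * max_AP_free (ZMod_power p n) + 1)"
  unfolding zero_sum_bound_def
proof (intro allI impI, elim conjE, rule ccontr)
  fix I :: "nat set" and a :: "nat \<Rightarrow> nat \<Rightarrow> int"
  let ?G = "ZMod_power p n"
  assume I: "finite I" "(2 * p - 3) * max_AP_free ?G + 1 \<le> card I"
    and no: "\<not> (\<exists>J\<subseteq>I. card J = p \<and> (\<forall>i<n. int p dvd (\<Sum>j\<in>J. a j i)))"
  have p0: "p > 0" using p by simp
  let ?Q = "\<lambda>y M. M \<subseteq> I - {y} \<and> card M \<le> p - 2 \<and>
    (\<forall>x\<in>I - {y}. (\<forall>i<n. [a x i = a y i] (mod int p)) \<longrightarrow> x \<in> M) \<and>
    (\<forall>x\<in>I - {y}. \<forall>z\<in>I - {y}. x \<noteq> z \<longrightarrow> (\<forall>i<n. [a x i + a z i = 2 * a y i] (mod int p)) \<longrightarrow>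
       x \<in> M \<or> z \<in> M)"
  have "\<forall>y\<in>I. \<exists>M. ?Q y M"
    by (intro ballI midpoint_hitting_set I p0 no)
  from bchoice[OF this] obtain M where M: "\<forall>y\<in>I. ?Q y (M y)" ..
  have finM: "finite (M y)" if "y \<in> I" for y
    using bspec[OF M that] I(1) by (meson finite_Diff finite_subset)
  have deg: "2 * (p - 2) + 1 = 2 * p - 3"
    using p by simp
  have "\<exists>S\<subseteq>I. card I \<le> (2 * (p - 2) + 1) * card S \<and> (\<forall>x\<in>S. \<forall>y\<in>S. x \<noteq> y \<longrightarrow> y \<notin> M x)"
    by (rule independent_set_bounded_outdegree) (use I(1) finM M in auto)
  then obtain S where S: "S \<subseteq> I" "card I \<le> (2 * p - 3) * card S"
    and indep: "\<And>x y. x \<in> S \<Longrightarrow> y \<in> S \<Longrightarrow> x \<noteq> y \<Longrightarrow> y \<notin> M x"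
    unfolding deg by blast
  define v where "v j = (\<lambda>i\<in>{..<n}. a j i mod int p)" for j
  have "inj_on v S"
  proof (rule inj_onI, rule ccontr)
    fix x y assume xy: "x \<in> S" "y \<in> S" "v x = v y" "x \<noteq> y"
    have "\<forall>i<n. [a x i = a y i] (mod int p)"
      using fun_cong[OF xy(3)] unfolding v_def cong_def by (metis lessThan_iff restrict_apply')
    then show False
      using bspec[OF M, of y] indep[of y x] xy S(1) by blast
  qed
  have "v ` S \<subseteq> carrier ?G"
    using p by (auto simp: carrier_ZMod_power v_def)
  moreover have "\<not> (\<exists>P\<subseteq>v ` S. three_term_AP ?G P)"
  proof
    assume "\<exists>P\<subseteq>v ` S. three_term_AP ?G P"
    then obtain P x' y' z' where "P \<subseteq> v ` S" "P = {x', y', z'}"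
      and neq: "x' \<noteq> y'" "y' \<noteq> z'" "x' \<noteq> z'"
      and AP': "x' \<otimes>\<^bsub>?G\<^esub> z' = y' [^]\<^bsub>?G\<^esub> (2::nat)"
      unfolding three_term_AP_def by (elim exE bexE conjE)
    then have "x' \<in> v ` S" "y' \<in> v ` S" "z' \<in> v ` S"
      by simp_all
    then obtain x y z where v: "x' = v x" "y' = v y" "z' = v z" and S3: "x \<in> S" "y \<in> S" "z \<in> S"
      by (elim imageE)
    have xyz: "x \<in> S" "y \<in> S" "z \<in> S" "x \<noteq> y" "y \<noteq> z" "x \<noteq> z"
      using S3 neq v by auto
    have AP: "v x \<otimes>\<^bsub>?G\<^esub> v z = v y [^]\<^bsub>?G\<^esub> (2::nat)"
      using AP' v by simp
    have "[a x i + a z i = 2 * a y i] (mod int p)" if "i < n" for i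
      using fun_cong[OF AP, of i] that
      by (simp add: mult_ZMod_power pow_ZMod_power v_def cong_def mod_simps)
    then show False
      using bspec[OF M, of y] indep[of y x] indep[of y z] xyz S(1) by blast
  qed
  ultimately have "card (v ` S) \<le> max_AP_free ?G"
    by (intro card_le_max_AP_free finite_carrier_ZMod_power p0)
  then have "card S \<le> max_AP_free ?G"
    using \<open>inj_on v S\<close> by (simp add: card_image)
  then have "(2 * p - 3) * card S \<le> (2 * p - 3) * max_AP_free ?G"
    by (rule mult_le_mono2)
  then show False
    using S(2) I(2) by linarith
qed

section \<open>Composite moduli\<close>

text \<open>Induction splitting off a prime \<open>p\<close>: blocks of length \<open>b\<close> come
  first, then the bound for \<open>p\<close> is applied to their quotients. The constant 2 survives
  since \<open>(2 * p - 3) + 2 \<le> 2 * p\<close>.\<close>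

lemma zero_sum_bound_prime_factors:
  assumes "k > 0"
  shows "zero_sum_bound k n (2 * k * (\<Sum>p\<in>prime_factors k. max_AP_free (ZMod_power p n)) + 1)"
  using assms
proof (induction k rule: prime_divisors_induct)
  case (unit k)
  \<comment> \<open>For modulus 1 the sum over primes is empty, the bound is 1, and any single index
    works.\<close>
  have "\<exists>J\<subseteq>I. card J = 1" if "1 \<le> card I" for I :: "nat set"
    using that obtain_subset_with_card_n by metis
  then show ?case
    using unit by (simp add: zero_sum_bound_def)
next
  case (factor p b)
  let ?r = "\<lambda>p. max_AP_free (ZMod_power p n)"
  let ?S = "\<lambda>k. \<Sum>p\<in>prime_factors k. ?r p"
  have b: "b > 0" using factor.prems by auto
  have p: "p \<ge> 2" "p > 0" using factor.hyps prime_ge_2_nat prime_gt_0_nat by blast+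
  have pf: "prime_factors (p * b) = insert p (prime_factors b)"
    using p b factor.hyps by (simp add: prime_factors_product prime_prime_factors)
  \<comment> \<open>Inequalities suffice and also cover the case that \<open>p\<close> already
    divides \<open>b\<close>.\<close>
  have "?S b \<le> ?S (p * b)" "?r p \<le> ?S (p * b)"
    unfolding pf by (auto intro!: sum_mono2 member_le_sum)
  then have "b * ((2 * p - 3) * ?r p) + 2 * b * ?S b
      \<le> b * ((2 * p - 3) * ?S (p * b)) + 2 * b * ?S (p * b)"
    by (intro add_mono mult_le_mono) auto
  also have "\<dots> = (b * ?S (p * b)) * ((2 * p - 3) + 2)"
    by (simp add: algebra_simps)
  also have "\<dots> \<le> (b * ?S (p * b)) * (2 * p)"
    by (intro mult_le_mono2) (use p in linarith)
  finally have "b * ((2 * p - 3) * ?r p) + 2 * b * ?S b + 1 \<le> 2 * (p * b) * ?S (p * b) + 1"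
    by (simp add: mult_ac)
  moreover have "zero_sum_bound (b * p) n (b * ((2 * p - 3) * ?r p) + 2 * b * ?S b + 1)"
    by (intro zero_sum_bound_mult factor.IH b zero_sum_bound_AP_free p)
  ultimately show ?case
    using zero_sum_bound_mono by (simp add: mult.commute[of b p])
qed auto

section \<open>From index sets back to sequences\<close>

lemma sum_list_map_nths:
  "(\<Sum>x\<leftarrow>nths xs J. f x) = (\<Sum>j\<in>{j\<in>J. j < length xs}. f (xs ! j))" for f :: "'a \<Rightarrow> 'b::comm_monoid_add"
proof (induction xs rule: rev_induct)
  case (snoc x xs)
  have "{j\<in>J. j < length (xs @ [x])} =
      {j\<in>J. j < length xs} \<union> (if length xs \<in> J then {length xs} else {})"
    by (auto simp: less_Suc_eq)
  then show ?case
    using snoc by (auto simp: nths_append nth_append sum.union_disjoint add.commute intro!: sum.cong)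
qed simp

text \<open>The positions of a list serve as the index set, and \<open>nths\<close> turns the chosen
  positions into a subsequence.\<close>

lemma egz_constant_le:
  assumes "k \<ge> 2" and "n \<ge> 1" and "zero_sum_bound k n N"
  shows "egz_constant (ZMod_power k n) \<le> N"
  unfolding egz_constant_def
proof (rule Least_le, intro allI impI)
  fix xs :: "(nat \<Rightarrow> int) list"
  assume xs: "set xs \<subseteq> carrier (ZMod_power k n) \<and> length xs = N"
  obtain J where J: "J \<subseteq> {..<length xs}" "card J = k"
    "\<And>i. i < n \<Longrightarrow> int k dvd (\<Sum>j\<in>J. (xs ! j) i)"
    using zero_sum_boundD[OF assms(3), of "{..<length xs}" "\<lambda>j. xs ! j"] xs by auto
  have eq: "{j\<in>J. j < length xs} = J" "{j. j < length xs \<and> j \<in> J} = J"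
    using J(1) by auto
  have "length (nths xs J) = group_exponent (ZMod_power k n)"
    using J(2) eq assms by (simp add: length_nths group_exponent_ZMod_power)
  moreover have "seq_sum (ZMod_power k n) (nths xs J) = \<one>\<^bsub>ZMod_power k n\<^esub>"
    using J(3) eq by (auto simp: seq_sum_ZMod_power one_ZMod_power sum_list_map_nths fun_eq_iff)
  ultimately show "\<exists>ys. subseq ys xs \<and> length ys = group_exponent (ZMod_power k n) \<and>
      seq_sum (ZMod_power k n) ys = \<one>\<^bsub>ZMod_power k n\<^esub>"
    using subseq_conv_nths by blast
qed

theorem corollary2:
  fixes k n :: nat
  assumes "k \<ge> 2" and "n \<ge> 1"
  shows "egz_constant (ZMod_power k n)
           < 3 * k * (\<Sum>p\<in>prime_factors k. max_AP_free (ZMod_power p n))"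
proof -
  define S where "S = (\<Sum>p\<in>prime_factors k. max_AP_free (ZMod_power p n))"
  obtain p where p: "p \<in> prime_factors k"
    using assms(1) prime_factor_nat[of k] by (auto simp: in_prime_factors_iff)
  then have "p > 0"
    by (auto intro: prime_gt_0_nat)
  then have "max_AP_free (ZMod_power p n) > 0"
    by (intro max_AP_free_pos[of _ "\<one>\<^bsub>ZMod_power p n\<^esub>"] finite_carrier_ZMod_power
        monoid.one_closed group.is_monoid group_ZMod_power)
  moreover have "max_AP_free (ZMod_power p n) \<le> S"
    unfolding S_def by (rule member_le_sum) (use p in auto)
  \<comment> \<open>Since \<open>k * S \<ge> k \<ge> 2\<close>, the summand 1 in
    \<open>2 * k * S + 1\<close> is strictly less than \<open>k * S\<close>.\<close>
  ultimately have "k \<le> k * S"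
    by simp
  moreover have "egz_constant (ZMod_power k n) \<le> 2 * k * S + 1"
    unfolding S_def using assms by (intro egz_constant_le zero_sum_bound_prime_factors) auto
  ultimately show ?thesis
    unfolding S_def[symmetric] mult.assoc using assms(1) by linarith
qed

end
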